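(* For all integers $N\geqslant1$ and all $\gamma\in(0,\gamma_0]$ such that $\kappa_\gamma>0$, $$\mathcal W_{\rho_N}\left(\mu_{\infty,N,\gamma},\overline\mu_{\infty,N}\right)\leqslant\sqrt\gamma\,N\kappa_\gamma^{-1}C_5,$$ where $\mu_{\infty,N,\gamma}$ is the unique invariant measure of $R_{N,\gamma}$ and $\overline\mu_{\infty,N}$ is the unique invariant measure of $(P_{N,t})_{t\geqslant0}$.
   Context: $\mathbb T^d=\mathbb R^d/\mathbb Z^d$ is the flat torus with Euclidean distance $|x-y|$; $b\in\mathcal C^1(\mathbb T^d)$ is an $\mathbb R^d$-valued drift; $\lambda:\mathbb T^d\to[0,\infty)$ is Lipschitz with constant $L_\lambda$ (standing assumption). $\mathcal P(F)$ is the set of Borel probability measures on $F$; $\mathcal W_\rho(\mu,\nu)=\inf\{\mathbb E(\rho(X,Y)):X\sim\mu,\ Y\sim\nu\}$ for a distance $\rho$. Discrete system: for $\gamma>0$, $K$ is the Markov kernel on $\mathbb T^d$ given by $Kf(x)=(2\pi)^{-d/2}\int_{\mathbb R^d}f(x+\gamma b(x)+\sqrt\gamma y)e^{-|y|^2/2}dy$, and $p(z)=1-e^{-\gamma\lambda(z)}$. For $\mu\in\mathcal P(\mathbb T^d)$, $Q_\mu(x,\cdot)$ is the law of $X_H$, where $(X_k,U_k)_{k\in\mathbb N}$ are independent random variables with, for every $k$, $X_k$ and $U_k$ independent, $U_k$ uniform on $[0,1]$, $X_0\sim K(x,\cdot)$, $X_k\sim\mu K$ for $k\geqslant1$, and $H=\inf\{k\in\mathbb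 N:U_k\geqslant p(X_k)\}$. For $x\in\mathbb T^{dN}$, $\pi(x)=\frac1N\sum_{i=1}^N\delta_{x_i}$ and $R_{N,\gamma}(x,\cdot)=Q_{\pi(x)}(x_1,\cdot)\otimes\cdots\otimes Q_{\pi(x)}(x_N,\cdot)$. Continuous-time system: let $(E_{i,k},B_{i,k},J_{i,k})_{1\leqslant i\leqslant N,k\in\mathbb N}$ be independent triplets of independent variables, $E_{i,k}$ exponential of parameter 1, $B_{i,k}$ a $d$-dimensional Brownian motion, $J_{i,k}$ uniform on $\{1,\dots,N\}$ (except $J_{i,0}=i$). Given $x\in\mathbb T^{dN}$, set $\overline{\mathbf X}_0=x$, $T_{i,0}=0$, $\hat X_{i,0,0}=x_i$ and, for $k\geqslant1$, $\hat X_{i,k,T_{i,k}}=\lim_{t\uparrow T_{i,k}}\overline X_{J_{i,k},t}$. For $k\in\mathbb N$ and $t\geqslant T_{i,k}$ let $d\hat X_{i,k,t}=b(\hat X_{i,k,t})dt+dB_{i,k,t}$, set $T_{i,k+1}=\inf\{t\geqslant T_{i,k}:E_{i,k}\leqslant\int_{T_{i,k}}^t\lambda(\hat X_{i,k,s})ds\}$, and $\overline X_{i,t}=\hat X_{i,k,t}$ for $t\in[T_{i,k},T_{i,k+1})$. This defines a Markov process $\overline{\mathbf X}_t=(\overline X_{1,t},\dots,\overline X_{N,t})$, $t\geqslant0$; $(P_{N,t})_{t\geqslant0}$ is its semigroup, $P_{N,t}f(x)=\mathbb E(f(\overline{\mathbf X}_t)\mid\overline{\mathbf X}_0=x)$.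 Constants (fixed throughout, such constants exist): $c_1,a,\gamma_0>0$ depend only on $b$ and $d$ and are such that, with the metric $\rho(x,y)=(1-e^{-a|x-y|})/a$ on $\mathbb T^d$, $\mathcal W_\rho(\mu K,\nu K)\leqslant(1-c_1\gamma)\mathcal W_\rho(\mu,\nu)$ for all $\gamma\in(0,\gamma_0]$ and $\mu,\nu\in\mathcal P(\mathbb T^d)$; $c_2>0$ depends only on $b$ and $d$ and is such that, with $\kappa_\gamma=c_1-c_2L_\lambda e^{\gamma\|\lambda\|_\infty}$ and $\rho_N(x,y)=\sum_{i=1}^N\rho(x_i,y_i)$, one has $\mathcal W_{\rho_N}(\mu R_{N,\gamma},\nu R_{N,\gamma})\leqslant(1-\gamma\kappa_\gamma)\mathcal W_{\rho_N}(\mu,\nu)$ for all $\gamma\in(0,\gamma_0]$, $N\geqslant1$ and $\mu,\nu\in\mathcal P(\mathbb T^{dN})$. $C_5>0$ is a constant (such a constant exists) such that $\mathcal W_{\rho_N}(\mu R_{N,\gamma}^m,\mu P_{N,m\gamma})\leqslant\sqrt\gamma NC_5\gamma\sum_{s=1}^m(1-\gamma\kappa_\gamma)^{s-1}$ for all $N\geqslant1$, $\gamma\in(0,\gamma_0]$, $m\in\mathbb N$, $\mu\in\mathcal P(\mathbb T^{dN})$. When $\kappa_\gamma>0$, both $R_{N,\gamma}$ and $(P_{N,t})_{t\geqslant0}$ admit unique invariant probability measures. *)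

theory Defs
  imports "HOL-Probability.Probability"
begin

subsection \<open>The flat torus\<close>

definition torus_rel :: "real ^ 'd \<Rightarrow> real ^ 'd \<Rightarrow> bool" where
  "torus_rel x y \<longleftrightarrow> (\<forall>i. x $ i - y $ i \<in> \<int>)"

lemma equivp_torus_rel: "equivp torus_rel"
proof (rule equivpI)
  show "reflp torus_rel"
    by (simp add: reflp_def torus_rel_def)
  show "symp torus_rel"
    unfolding symp_def torus_rel_def by (metis Ints_minus minus_diff_eq)
  show "transp torus_rel"
  proof (rule transpI)
    fix x y z :: "real ^ 'd" assume *: "torus_rel x y" "torus_rel y z"
    show "torus_rel x z"
      unfolding torus_rel_def
    proof
      fix i
      have "(x $ i - y $ i) + (y $ i - z $ i) \<in> \<int>"
        using * unfolding torus_rel_def by (intro Ints_add) auto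
      then show "x $ i - z $ i \<in> \<int>" by simp
    qed
  qed
qed

quotient_type 'd torus = "real ^ 'd" / torus_rel
  by (rule equivp_torus_rel)

lift_definition torus_class :: "real ^ 'd \<Rightarrow> ('d::finite) torus" is "\<lambda>x. x" .

lift_definition torus_shift :: "('d::finite) torus \<Rightarrow> real ^ 'd \<Rightarrow> 'd torus" is "\<lambda>x v. x + v"
  by (simp add: torus_rel_def)

lemma torus_class_surj: "\<exists>u. torus_class u = x"
  by transfer (rule exI, rule equivp_reflp[OF equivp_torus_rel])

lemma torus_class_eq_iff: "torus_class u = torus_class v \<longleftrightarrow> torus_rel u v"
  by transfer simp

lemma torus_class_add_eq:
  assumes "torus_class u = torus_class v"
  shows "torus_class (u + w) = torus_class (v + w)"
  using assms by (simp add: torus_class_eq_iff torus_rel_def)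

instantiation torus :: (finite) metric_space
begin

definition dist_torus :: "'a torus \<Rightarrow> 'a torus \<Rightarrow> real" where
  "dist_torus x y = Inf {norm (u - v) | u v. torus_class u = x \<and> torus_class v = y}"

definition uniformity_torus :: "('a torus \<times> 'a torus) filter" where
  "uniformity_torus = (INF e\<in>{0 <..}. principal {(x, y). dist x y < e})"

definition open_torus :: "'a torus set \<Rightarrow> bool" where
  "open_torus U \<longleftrightarrow> (\<forall>x\<in>U. eventually (\<lambda>(x', y). x' = x \<longrightarrow> y \<in> U) uniformity)"

instance
proof
  have bdd: "bdd_below {norm (u - v) | u v. torus_class u = x \<and> torus_class v = y}"
    for x y :: "'a torus"
    by (rule bdd_belowI[of _ 0]) auto
  have ne: "{norm (u - v) | u v. torus_class u = x \<and> torus_class v = y} \<noteq> {}"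
    for x y :: "'a torus"
    using torus_class_surj[of x] torus_class_surj[of y] by blast
  have upper: "dist x y \<le> norm (u - v)" if "torus_class u = x" "torus_class v = y"
    for x y :: "'a torus" and u v
    unfolding dist_torus_def by (rule cInf_lower[OF _ bdd]) (use that in blast)
  have approx: "\<exists>u v. torus_class u = x \<and> torus_class v = y \<and> norm (u - v) < dist x y + e"
    if "0 < e" for x y :: "'a torus" and e
  proof -
    have "Inf {norm (u - v) | u v. torus_class u = x \<and> torus_class v = y} < dist x y + e"
      unfolding dist_torus_def[symmetric] using that by linarith
    from cInf_lessD[OF ne this] show ?thesis by blast
  qed
  show "uniformity = (INF e\<in>{0 <..}. principal {(x::'a torus, y). dist x y < e})"
    by (rule uniformity_torus_def)
  show "open U \<longleftrightarrow> (\<forall>x\<in>U. eventually (\<lambda>(x', y). x' = x \<longrightarrow> y \<in> U) uniformity)"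
    for U :: "'a torus set"
    by (rule open_torus_def)
  show "(dist x y = 0) = (x = y)" for x y :: "'a torus"
  proof
    assume "x = y"
    obtain u where "torus_class u = x" using torus_class_surj by blast
    with \<open>x = y\<close> have "dist x y \<le> 0" using upper[of u x u y] by simp
    moreover have "0 \<le> dist x y"
      unfolding dist_torus_def by (rule cInf_greatest[OF ne]) auto
    ultimately show "dist x y = 0" by simp
  next
    assume "dist x y = 0"
    then have ap: "\<exists>u v. torus_class u = x \<and> torus_class v = y \<and> norm (u - v) < e"
      if "0 < e" for e
      using approx[OF that, of x y] by simp
    have "(0::real) < 1 / 2" by simp
    from ap[OF this] obtain u v where uv: "torus_class u = x" "torus_class v = y"
      and "norm (u - v) < 1 / 2" by blast
    have "u $ i = v $ i" for i
    proof (rule ccontr)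
      assume neq: "u $ i \<noteq> v $ i"
      define d where "d = \<bar>u $ i - v $ i\<bar>"
      have d: "0 < d" "d < 1/2"
        using neq component_le_norm_cart[of "u - v" i] \<open>norm (u - v) < 1 / 2\<close>
        by (auto simp: d_def)
      from ap[OF d(1)] obtain u' v' where uv': "torus_class u' = x" "torus_class v' = y"
        and "norm (u' - v') < d" by blast
      then have less: "\<bar>u' $ i - v' $ i\<bar> < d"
        using component_le_norm_cart[of "u' - v'" i] by simp
      have "u $ i - u' $ i \<in> \<int>" "v $ i - v' $ i \<in> \<int>"
        using trans[OF uv(1) uv'(1)[symmetric]] trans[OF uv(2) uv'(2)[symmetric]]
        by (simp_all add: torus_class_eq_iff torus_rel_def)
      then have "(u $ i - u' $ i) - (v $ i - v' $ i) \<in> \<int>"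
        by (rule Ints_diff)
      then obtain k :: int where k: "(u $ i - v $ i) - (u' $ i - v' $ i) = of_int k"
        by (elim Ints_cases) (simp add: algebra_simps)
      then have "\<bar>of_int k :: real\<bar> < 1"
        using less d unfolding d_def by linarith
      then have "k = 0" by linarith
      then show False using k less by (simp add: d_def)
    qed
    then have "u = v" by (simp add: vec_eq_iff)
    then show "x = y" using uv by simp
  qed
  show "dist x y \<le> dist x z + dist y z" for x y z :: "'a torus"
  proof (rule field_le_epsilon)
    fix e :: real assume "0 < e"
    then have "0 < e / 2" by simp
    from approx[OF this, of x z] obtain u w where uw: "torus_class u = x" "torus_class w = z"
        "norm (u - w) < dist x z + e / 2" by blast
    from approx[OF \<open>0 < e / 2\<close>, of y z] obtain v w' where vw: "torus_class v = y"
        "torus_class w' = z" "norm (v - w') < dist y z + e / 2" by blast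
    note * = uw vw
    have "torus_class (w - w') = torus_class 0"
      using trans[OF *(2) *(5)[symmetric]] by (simp add: torus_class_eq_iff torus_rel_def)
    then have "torus_class (v + (w - w')) = y"
      using torus_class_add_eq[of "w - w'" 0 v] *(4) by (simp add: add.commute)
    then have "dist x y \<le> norm (u - (v + (w - w')))"
      by (rule upper[OF *(1)])
    also have "\<dots> = norm ((u - w) - (v - w'))" by (simp add: algebra_simps)
    also have "\<dots> \<le> norm (u - w) + norm (v - w')" by (rule norm_triangle_ineq4)
    finally show "dist x y \<le> dist x z + dist y z + e" using *(3,6) by simp
  qed
qed

end

definition C1_torus :: "(('d::finite) torus \<Rightarrow> real ^ 'd) \<Rightarrow> bool" where
  "C1_torus b \<longleftrightarrow> (\<exists>D :: real ^ 'd \<Rightarrow> (real ^ 'd) \<Rightarrow>\<^sub>L (real ^ 'd).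
     (\<forall>u. ((\<lambda>v. b (torus_class v)) has_derivative blinfun_apply (D u)) (at u)) \<and>
     continuous_on UNIV D)"

text \<open>
  Configurations of \<open>N\<close> particles are extensional functions on \<open>{1..N}\<close>; as the torus is
  second countable, the product \<open>\<sigma>\<close>-algebra below is the Borel \<open>\<sigma>\<close>-algebra of the
  product space.
\<close>

definition configs :: "nat \<Rightarrow> (nat \<Rightarrow> ('d::finite) torus) measure" where
  "configs N = (\<Pi>\<^sub>M i\<in>{1..N}. borel)"


subsection \<open>Wasserstein distance\<close>

definition couplings :: "'a measure \<Rightarrow> 'a measure \<Rightarrow> ('a \<times> 'a) measure set" where
  "couplings \<mu> \<nu> =
     {\<xi> \<in> space (prob_algebra (\<mu> \<Otimes>\<^sub>M \<nu>)). distr \<xi> \<mu> fst = \<mu> \<and> distr \<xi> \<nu> snd = \<nu>}"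

definition wasserstein :: "('a \<Rightarrow> 'a \<Rightarrow> real) \<Rightarrow> 'a measure \<Rightarrow> 'a measure \<Rightarrow> real" where
  "wasserstein r \<mu> \<nu> = (INF \<xi>\<in>couplings \<mu> \<nu>. \<integral>z. r (fst z) (snd z) \<partial>\<xi>)"

definition rho :: "real \<Rightarrow> ('d::finite) torus \<Rightarrow> 'd torus \<Rightarrow> real" where
  "rho a x y = (1 - exp (- a * dist x y)) / a"

definition rho_N :: "real \<Rightarrow> nat \<Rightarrow> (nat \<Rightarrow> ('d::finite) torus) \<Rightarrow> (nat \<Rightarrow> 'd torus) \<Rightarrow> real" where
  "rho_N a N x y = (\<Sum>i=1..N. rho a (x i) (y i))"


subsection \<open>The discrete system\<close>

definition std_gaussian :: "(real ^ 'd) measure" where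
  "std_gaussian = density lborel
     (\<lambda>y. ennreal ((2 * pi) powr (- real CARD('d) / 2) * exp (- (norm y)\<^sup>2 / 2)))"

definition euler_kernel ::
  "(('d::finite) torus \<Rightarrow> real ^ 'd) \<Rightarrow> real \<Rightarrow> 'd torus \<Rightarrow> 'd torus measure" where
  "euler_kernel b \<gamma> x =
     distr std_gaussian borel (\<lambda>y. torus_shift x (\<gamma> *\<^sub>R b x + sqrt \<gamma> *\<^sub>R y))"

definition kill_prob :: "(('d::finite) torus \<Rightarrow> real) \<Rightarrow> real \<Rightarrow> 'd torus \<Rightarrow> real" where
  "kill_prob lam \<gamma> z = 1 - exp (- \<gamma> * lam z)"

text \<open>
  The sequence of pairs \<open>(X_k, U_k)\<close> is realised as the coordinate process on a product space.
  For bounded \<open>lam\<close> the set of sequences on which the \<open>LEAST\<close> below is taken over an empty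
  set is null.
\<close>

definition Q_kernel ::
  "(('d::finite) torus \<Rightarrow> real ^ 'd) \<Rightarrow> ('d torus \<Rightarrow> real) \<Rightarrow> real \<Rightarrow> 'd torus measure \<Rightarrow>
     'd torus \<Rightarrow> 'd torus measure" where
  "Q_kernel b lam \<gamma> \<mu> x =
     distr
       (\<Pi>\<^sub>M k\<in>(UNIV :: nat set).
          (if k = 0 then euler_kernel b \<gamma> x else \<mu> \<bind> euler_kernel b \<gamma>)
            \<Otimes>\<^sub>M uniform_measure lborel {0..1::real})
       borel
       (\<lambda>\<omega>. fst (\<omega> (LEAST k. snd (\<omega> k) \<ge> kill_prob lam \<gamma> (fst (\<omega> k)))))"

definition empirical :: "nat \<Rightarrow> (nat \<Rightarrow> ('d::finite) torus) \<Rightarrow> 'd torus measure" where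
  "empirical N x = distr (uniform_count_measure {1..N}) borel x"

definition R_kernel ::
  "(('d::finite) torus \<Rightarrow> real ^ 'd) \<Rightarrow> ('d torus \<Rightarrow> real) \<Rightarrow> nat \<Rightarrow> real \<Rightarrow>
     (nat \<Rightarrow> 'd torus) \<Rightarrow> (nat \<Rightarrow> 'd torus) measure" where
  "R_kernel b lam N \<gamma> x = (\<Pi>\<^sub>M i\<in>{1..N}. Q_kernel b lam \<gamma> (empirical N x) (x i))"


subsection \<open>The continuous-time system\<close>

definition brownian_motion :: "'w measure \<Rightarrow> (real \<Rightarrow> 'w \<Rightarrow> real ^ ('d::finite)) \<Rightarrow> bool" where
  "brownian_motion \<Omega> B \<longleftrightarrow>
     prob_space \<Omega> \<and>
     (\<forall>t\<ge>0. B t \<in> borel_measurable \<Omega>) \<and>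
     (\<forall>\<omega>\<in>space \<Omega>. B 0 \<omega> = 0 \<and> continuous_on {0..} (\<lambda>t. B t \<omega>)) \<and>
     (\<forall>s t. 0 \<le> s \<and> s < t \<longrightarrow>
        distr \<Omega> borel (\<lambda>\<omega>. B t \<omega> - B s \<omega>) =
        distr std_gaussian borel (\<lambda>y. sqrt (t - s) *\<^sub>R y)) \<and>
     (\<forall>n (\<tau> :: nat \<Rightarrow> real). 0 \<le> \<tau> 0 \<and> (\<forall>j<n. \<tau> j < \<tau> (Suc j)) \<longrightarrow>
        prob_space.indep_vars \<Omega> (\<lambda>_. borel) (\<lambda>j \<omega>. B (\<tau> (Suc j)) \<omega> - B (\<tau> j) \<omega>) {..<n})"

definition driving_noise ::
  "'w measure \<Rightarrow> nat \<Rightarrow> (nat \<Rightarrow> nat \<Rightarrow> 'w \<Rightarrow> real) \<Rightarrow>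
     (nat \<Rightarrow> nat \<Rightarrow> real \<Rightarrow> 'w \<Rightarrow> real ^ ('d::finite)) \<Rightarrow> (nat \<Rightarrow> nat \<Rightarrow> 'w \<Rightarrow> nat) \<Rightarrow> bool" where
  "driving_noise \<Omega> N E B J \<longleftrightarrow>
     (let paths = (\<Pi>\<^sub>M t\<in>{0::real..}. (borel :: (real ^ 'd) measure));
          S = borel \<Otimes>\<^sub>M paths \<Otimes>\<^sub>M count_space {1..N};
          W = (\<lambda>i k \<omega>. \<lambda>t\<in>{0..}. B i k t \<omega>);
          Y = (\<lambda>i k \<omega>. (E i k \<omega>, W i k \<omega>, J i k \<omega>))
      in prob_space \<Omega> \<and>
         (\<forall>i\<in>{1..N}. \<forall>k.
            distributed \<Omega> lborel (E i k) (exponential_density 1) \<and>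
            brownian_motion \<Omega> (B i k) \<and>
            J i k \<in> \<Omega> \<rightarrow>\<^sub>M count_space {1..N} \<and>
            (if k = 0 then \<forall>\<omega>\<in>space \<Omega>. J i k \<omega> = i
             else distr \<Omega> (count_space {1..N}) (J i k) = uniform_count_measure {1..N}) \<and>
            distr \<Omega> S (Y i k) =
              distr \<Omega> borel (E i k) \<Otimes>\<^sub>M distr \<Omega> paths (W i k)
                \<Otimes>\<^sub>M distr \<Omega> (count_space {1..N}) (J i k)) \<and>
         prob_space.indep_vars \<Omega> (\<lambda>_. S) (\<lambda>(i, k). Y i k) ({1..N} \<times> UNIV))"

text \<open>
  Since the noise is additive, \<open>dy = b(y) dt + dw\<close> is an integral equation along each path.
\<close>

definition solves_sde ::
  "(('d::finite) torus \<Rightarrow> real ^ 'd) \<Rightarrow> (real \<Rightarrow> real ^ 'd) \<Rightarrow> real \<Rightarrow> (real \<Rightarrow> 'd torus) \<Rightarrow> bool" where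
  "solves_sde b w s y \<longleftrightarrow>
     continuous_on {s..} y \<and>
     (\<forall>t\<ge>s. y t = torus_shift (y s) (integral {s..t} (\<lambda>r. b (y r)) + (w t - w s)))"

text \<open>
  One realisation of the particle system, with driving data \<open>e\<close>, \<open>w\<close>, \<open>j\<close>.  A jump time may be
  infinite (\<open>lam\<close> may vanish), and all later ones are then infinite too, being infima of empty
  sets.
\<close>

definition particle_path ::
  "(('d::finite) torus \<Rightarrow> real ^ 'd) \<Rightarrow> ('d torus \<Rightarrow> real) \<Rightarrow> nat \<Rightarrow> (nat \<Rightarrow> 'd torus) \<Rightarrow>
     (nat \<Rightarrow> nat \<Rightarrow> real) \<Rightarrow> (nat \<Rightarrow> nat \<Rightarrow> real \<Rightarrow> real ^ 'd) \<Rightarrow> (nat \<Rightarrow> nat \<Rightarrow> nat) \<Rightarrow>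
     (nat \<Rightarrow> nat \<Rightarrow> ereal) \<Rightarrow> (nat \<Rightarrow> nat \<Rightarrow> real \<Rightarrow> 'd torus) \<Rightarrow> (nat \<Rightarrow> real \<Rightarrow> 'd torus) \<Rightarrow> bool" where
  "particle_path b lam N x e w j T Xh X \<longleftrightarrow>
     (\<forall>i\<in>{1..N}.
        T i 0 = 0 \<and> Xh i 0 0 = x i \<and>
        (\<forall>k s. T i k = ereal s \<longrightarrow>
           (k \<ge> 1 \<longrightarrow> ((\<lambda>t. X (j i k) t) \<longlongrightarrow> Xh i k s) (at_left s)) \<and>
           solves_sde b (w i k) s (Xh i k)) \<and>
        (\<forall>k. T i (Suc k) =
           Inf {ereal t | t. T i k \<le> ereal t \<and>
                  e i k \<le> integral {real_of_ereal (T i k)..t} (\<lambda>s. lam (Xh i k s))}) \<and>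
        (\<forall>k t. T i k \<le> ereal t \<and> ereal t < T i (Suc k) \<longrightarrow> X i t = Xh i k t))"

text \<open>
  The construction determines the path only almost surely (it may fail when two jump times of a
  particle coincide or when jump times accumulate).
\<close>

definition particle_system ::
  "'w measure \<Rightarrow> (('d::finite) torus \<Rightarrow> real ^ 'd) \<Rightarrow> ('d torus \<Rightarrow> real) \<Rightarrow> nat \<Rightarrow>
     (nat \<Rightarrow> nat \<Rightarrow> 'w \<Rightarrow> real) \<Rightarrow> (nat \<Rightarrow> nat \<Rightarrow> real \<Rightarrow> 'w \<Rightarrow> real ^ 'd) \<Rightarrow>
     (nat \<Rightarrow> nat \<Rightarrow> 'w \<Rightarrow> nat) \<Rightarrow>
     ((nat \<Rightarrow> 'd torus) \<Rightarrow> nat \<Rightarrow> real \<Rightarrow> 'w \<Rightarrow> 'd torus) \<Rightarrow> bool" where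
  "particle_system \<Omega> b lam N E B J X \<longleftrightarrow>
     driving_noise \<Omega> N E B J \<and>
     (\<forall>x\<in>space (configs N).
        (\<forall>i\<in>{1..N}. \<forall>t\<ge>0. X x i t \<in> borel_measurable \<Omega>) \<and>
        (AE \<omega> in \<Omega>. \<exists>T Xh. particle_path b lam N x
           (\<lambda>i k. E i k \<omega>) (\<lambda>i k t. B i k t \<omega>) (\<lambda>i k. J i k \<omega>) T Xh (\<lambda>i t. X x i t \<omega>)))"

definition P_kernel ::
  "'w measure \<Rightarrow> nat \<Rightarrow> ((nat \<Rightarrow> ('d::finite) torus) \<Rightarrow> nat \<Rightarrow> real \<Rightarrow> 'w \<Rightarrow> 'd torus) \<Rightarrow>
     real \<Rightarrow> (nat \<Rightarrow> 'd torus) \<Rightarrow> (nat \<Rightarrow> 'd torus) measure" where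
  "P_kernel \<Omega> N X t x = distr \<Omega> (configs N) (\<lambda>\<omega>. \<lambda>i\<in>{1..N}. X x i t \<omega>)"

definition invariant_measure :: "'a measure \<Rightarrow> ('a \<Rightarrow> 'a measure) \<Rightarrow> 'a measure \<Rightarrow> bool" where
  "invariant_measure S k \<mu> \<longleftrightarrow> \<mu> \<in> space (prob_algebra S) \<and> \<mu> \<bind> k = \<mu>"


subsection \<open>Constants\<close>

definition kappa ::
  "real \<Rightarrow> real \<Rightarrow> real \<Rightarrow> (('d::finite) torus \<Rightarrow> real) \<Rightarrow> real \<Rightarrow> real" where
  "kappa c1 c2 L lam \<gamma> = c1 - c2 * L * exp (\<gamma> * (SUP z. \<bar>lam z\<bar>))"

end

theory Submission
  imports Defs
begin

text \<open>
  Write \<open>R\<close>, \<open>P\<close> for the two kernels at time step \<open>\<gamma>\<close>.  Since \<open>\<mu> = \<mu>R\<close> and \<open>\<mu>' = \<mu>'P\<close>, the triangle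
  inequality through \<open>\<mu>'R\<close>, the contraction of \<open>R\<close> and the error bound for a single step (\<open>m = 1\<close>)
  give \<open>W(\<mu>, \<mu>') \<le> (1 - \<gamma> \<kappa>) W(\<mu>, \<mu>') + sqrt \<gamma> N C5 \<gamma>\<close>, which is the claim.  The measurability of
  \<open>R\<close> ensures that \<open>\<mu>'R\<close> is a probability measure.  The triangle inequality needs no disintegration:
  gluing two couplings along a countable partition of the middle space into cells of small diameter
  yields exact marginals and costs only the diameter.
\<close>

subsection \<open>Topology of the torus\<close>

lemma dist_torus_class_le: "dist (torus_class u) (torus_class v) \<le> norm (u - v)"
  unfolding dist_torus_def by (rule cInf_lower) (auto intro!: bdd_belowI[of _ 0])

lemma dist_torus_lift:
  fixes x y :: "('d::finite) torus"
  assumes "dist x y < e"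
  obtains u v where "torus_class u = x" "torus_class v = y" "norm (u - v) < e"
proof -
  have "{norm (u - v) | u v. torus_class u = x \<and> torus_class v = y} \<noteq> {}"
    using torus_class_surj[of x] torus_class_surj[of y] by blast
  from cInf_lessD[OF this assms[unfolded dist_torus_def]] that show thesis by blast
qed

text \<open>The displacement between two near-optimal representatives can be attached to any other
  representative of the first point: two representatives of one point differ by an integer vector,
  which may be added to both endpoints.\<close>

lemma dist_torus_lift_from:
  fixes x y :: "('d::finite) torus"
  assumes "dist x y < e" "torus_class u = x"
  obtains v where "torus_class v = y" "norm (u - v) < e"
proof -
  from dist_torus_lift[OF assms(1)] obtain u' v where *: "torus_class u' = x" "torus_class v = y" "norm (u' - v) < e" .
  have "torus_class (u' + (v - u')) = torus_class (u + (v - u'))"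
    using *(1) assms(2) by (intro torus_class_add_eq) simp
  then have "torus_class (u + (v - u')) = y" using *(2) by simp
  moreover have "norm (u - (u + (v - u'))) < e" using *(3) by (simp add: norm_minus_commute)
  ultimately show thesis by (rule that)
qed

text \<open>The projection from the Euclidean space does not increase distances, so it sends a
  countable dense set to a dense sequence. The sequence serves twice: for second countability, and
  for cutting the torus into countably many small cells.\<close>

lemma torus_dense_sequence:
  obtains q :: "nat \<Rightarrow> ('d::finite) torus" where "\<And>x e. 0 < e \<Longrightarrow> \<exists>k. dist x (q k) < e"
proof -
  obtain D :: "(real ^ 'd) set" where D: "countable D" "\<And>X. open X \<Longrightarrow> X \<noteq> {} \<Longrightarrow> \<exists>d\<in>D. d \<in> X"
    by (rule countable_dense_setE) (use that in blast)
  have "D \<noteq> {}" using D(2)[of UNIV] by auto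
  have "\<exists>k. dist x (torus_class (from_nat_into D k)) < e" if "0 < e" for x :: "'d torus" and e
  proof -
    obtain u where u: "torus_class u = x" using torus_class_surj by blast
    have "ball u e \<noteq> {}" using that by simp
    with D(2)[OF open_ball] obtain d where "d \<in> D" "d \<in> ball u e" by blast
    moreover obtain k where "from_nat_into D k = d"
      using from_nat_into_surj[OF D(1) \<open>d \<in> D\<close>] by blast
    ultimately show ?thesis
      using dist_torus_class_le[of u d] u by (intro exI[of _ k]) (auto simp: dist_norm)
  qed
  then show thesis by (rule that)
qed

text \<open>Second countability identifies the Borel sets of a product with the product
  \<sigma>-algebra, so that jointly continuous maps such as \<open>dist\<close> and
  \<open>torus_shift\<close> are measurable for pairs of measurable arguments.\<close>

instance torus :: (finite) second_countable_topology
proof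
  obtain q :: "nat \<Rightarrow> 'a torus" where q: "\<And>x e. 0 < e \<Longrightarrow> \<exists>k. dist x (q k) < e"
    using torus_dense_sequence by blast
  let ?B = "range (\<lambda>(k, n). ball (q k) (1 / real (Suc n)))"
  have "topological_basis ?B"
  proof (rule topological_basisI)
    fix O' and x :: "'a torus" assume "open O'" "x \<in> O'"
    then obtain e where e: "0 < e" "ball x e \<subseteq> O'" by (auto simp: open_contains_ball)
    \<comment> \<open>Half of \<open>e\<close> is enough: a ball of this radius that contains
      \<open>x\<close> has diameter below \<open>e\<close>, hence lies in
      \<open>ball x e\<close>.\<close>
    obtain n where n: "1 / real (Suc n) < e / 2"
      using reals_Archimedean[of "e / 2"] e(1) by (auto simp: inverse_eq_divide)
    obtain k where k: "dist x (q k) < 1 / real (Suc n)" using q[of "1 / real (Suc n)" x] by auto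
    have "ball (q k) (1 / real (Suc n)) \<subseteq> ball x e"
    proof
      fix y assume "y \<in> ball (q k) (1 / real (Suc n))"
      then show "y \<in> ball x e" using k n dist_triangle[of x y "q k"] by simp
    qed
    with e(2) k show "\<exists>B'\<in>?B. x \<in> B' \<and> B' \<subseteq> O'"
      by (intro bexI[of _ "ball (q k) (1 / real (Suc n))"]) (auto simp: dist_commute)
  qed auto
  from topological_basis_imp_subbasis[OF this]
  show "\<exists>B::'a torus set set. countable B \<and> open = generate_topology B"
    by (intro exI[of _ ?B]) auto
qed

text \<open>A point near \<open>x\<close> lifts to a vector near any prescribed representative of
  \<open>x\<close>, so the modulus of continuity of the lifted function at that vector also works on
  the torus.\<close>

lemma continuous_on_torusI:
  fixes f :: "('d::finite) torus \<Rightarrow> 'a::metric_space"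
  assumes "continuous_on UNIV (\<lambda>u. f (torus_class u))"
  shows "continuous_on UNIV f"
  unfolding continuous_on_iff
proof safe
  fix x :: "'d torus" and e :: real assume "0 < e"
  obtain u where u: "torus_class u = x" using torus_class_surj by blast
  from assms \<open>0 < e\<close> obtain d where d: "0 < d"
    "\<And>v. dist v u < d \<Longrightarrow> dist (f (torus_class v)) (f (torus_class u)) < e"
    unfolding continuous_on_iff by (metis UNIV_I)
  have "dist (f y) (f x) < e" if y: "dist y x < d" for y
  proof -
    from y have "dist x y < d" by (simp add: dist_commute)
    from dist_torus_lift_from[OF this u] obtain v where "torus_class v = y" "norm (u - v) < d" .
    then show ?thesis using d(2)[of v] u by (simp add: dist_norm norm_minus_commute)
  qed
  with d(1) show "\<exists>d>0. \<forall>y\<in>UNIV. dist y x < d \<longrightarrow> dist (f y) (f x) < e" by blast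
qed

lemma C1_torus_continuous: "C1_torus b \<Longrightarrow> continuous_on UNIV b"
  unfolding C1_torus_def
  by (intro continuous_on_torusI) (meson has_derivative_continuous continuous_at_imp_continuous_on)

lemma torus_shift_class: "torus_shift (torus_class u) v = torus_class (u + v)"
  by transfer (simp add: torus_rel_def)

text \<open>Shift representatives that realise \<open>dist x y\<close> up to \<open>e\<close> and
  use the Euclidean triangle inequality. This bound yields joint continuity of the shift, hence its
  measurability.\<close>

lemma dist_torus_shift_le:
  "dist (torus_shift x v) (torus_shift y w) \<le> dist x y + norm (v - w)"
proof (rule field_le_epsilon)
  fix e :: real assume "0 < e"
  from dist_torus_lift[of x y "dist x y + e"] \<open>0 < e\<close> obtain u u'
    where *: "torus_class u = x" "torus_class u' = y" "norm (u - u') < dist x y + e" by auto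
  have "dist (torus_shift x v) (torus_shift y w) \<le> norm ((u + v) - (u' + w))"
    unfolding *(1,2)[symmetric] torus_shift_class by (rule dist_torus_class_le)
  also have "\<dots> = norm ((u - u') + (v - w))" by (simp add: algebra_simps)
  also have "\<dots> \<le> norm (u - u') + norm (v - w)" by (rule norm_triangle_ineq)
  finally show "dist (torus_shift x v) (torus_shift y w) \<le> dist x y + norm (v - w) + e"
    using *(3) by simp
qed

lemma continuous_on_torus_shift:
  "continuous_on UNIV (\<lambda>z. torus_shift (fst z) (snd z) :: ('d::finite) torus)"
  unfolding continuous_on_iff
proof safe
  fix x :: "'d torus" and v and e :: real assume "0 < e"
  have "dist (torus_shift y w) (torus_shift x v) < e" if "dist (y, w) (x, v) < e / 2" for y w
    using dist_torus_shift_le[of y w x v] that dist_fst_le[of "(y, w)" "(x, v)"]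
      dist_snd_le[of "(y, w)" "(x, v)"] by (simp add: dist_norm)
  with \<open>0 < e\<close> show "\<exists>d>0. \<forall>z\<in>UNIV. dist z (x, v) < d \<longrightarrow>
      dist (torus_shift (fst z) (snd z)) (torus_shift (fst (x, v)) (snd (x, v))) < e"
    by (intro exI[of _ "e / 2"]) auto
qed

lemma measurable_torus_shift[measurable]:
  assumes [measurable]: "f \<in> M \<rightarrow>\<^sub>M borel" "g \<in> M \<rightarrow>\<^sub>M borel"
  shows "(\<lambda>z. torus_shift (f z) (g z)) \<in> M \<rightarrow>\<^sub>M borel"
  by (rule borel_measurable_continuous_Pair[OF assms continuous_on_torus_shift])

subsection \<open>Measurability of the kernels\<close>

text \<open>Over the standard basis the density factorises into one-dimensional standard normal
  densities, so its integral is a product of ones.\<close>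

lemma prob_space_std_gaussian: "prob_space (std_gaussian :: (real ^ 'd::finite) measure)"
proof
  have "emeasure (std_gaussian :: (real ^ 'd) measure) (space std_gaussian) =
     (\<integral>\<^sup>+y. ennreal ((2 * pi) powr (- real CARD('d) / 2) * exp (- (norm y)\<^sup>2 / 2)) \<partial>(lborel :: (real ^ 'd) measure))"
    by (simp add: std_gaussian_def emeasure_density)
  also have "\<dots> = (\<integral>\<^sup>+y. (\<Prod>b\<in>Basis. ennreal (std_normal_density (y \<bullet> b))) \<partial>(lborel :: (real ^ 'd) measure))"
  proof (rule nn_integral_cong)
    fix y :: "real ^ 'd"
    have "(1 / sqrt (2 * pi)) ^ CARD('d) = (2 * pi) powr (- real CARD('d) / 2)"
      by (simp add: powr_half_sqrt[symmetric] powr_minus_divide[symmetric] powr_powr powr_realpow[symmetric])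
    moreover have "(\<Sum>b\<in>Basis. - (y \<bullet> b)\<^sup>2 / 2) = - (norm y)\<^sup>2 / 2"
      by (simp add: norm_eq_sqrt_inner euclidean_inner[of y y] sum_nonneg sum_negf sum_divide_distrib[symmetric] power2_eq_square)
    moreover have "(\<Prod>b\<in>Basis. std_normal_density (y \<bullet> b)) =
        (1 / sqrt (2 * pi)) ^ CARD('d) * exp (\<Sum>b\<in>Basis. - (y \<bullet> b)\<^sup>2 / 2)"
      by (simp only: std_normal_density_def prod.distrib exp_sum finite_Basis prod_constant DIM_cart DIM_real mult_1_right)
    ultimately show "ennreal ((2 * pi) powr (- real CARD('d) / 2) * exp (- (norm y)\<^sup>2 / 2)) =
      (\<Prod>b\<in>Basis. ennreal (std_normal_density (y \<bullet> b)))"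
      by (simp only: prod_ennreal normal_density_nonneg)
  qed
  also have "\<dots> = (\<Prod>b\<in>(Basis :: (real ^ 'd) set). \<integral>\<^sup>+x. ennreal (std_normal_density x) \<partial>lborel)"
    by (rule nn_integral_lborel_prod) auto
  also have "\<dots> = 1"
    using prob_space.emeasure_space_1[OF prob_space_normal_density[of 1 0]]
    by (simp add: emeasure_density)
  finally show "emeasure (std_gaussian :: (real ^ 'd) measure) (space std_gaussian) = 1" .
qed

lemma sets_std_gaussian[measurable_cong]: "sets std_gaussian = sets borel"
  by (simp add: std_gaussian_def)

lemma std_gaussian_in_prob_algebra: "std_gaussian \<in> space (prob_algebra borel)"
  by (simp add: space_prob_algebra prob_space_std_gaussian sets_std_gaussian)

lemma measurable_euler_kernel:
  fixes b :: "('d::finite) torus \<Rightarrow> real ^ 'd"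
  assumes [measurable]: "b \<in> borel_measurable borel"
  shows "euler_kernel b \<gamma> \<in> borel \<rightarrow>\<^sub>M prob_algebra borel"
proof -
  have [measurable]: "(\<lambda>_. std_gaussian) \<in> (borel :: 'd torus measure) \<rightarrow>\<^sub>M prob_algebra borel"
    by (simp add: std_gaussian_in_prob_algebra)
  show ?thesis unfolding euler_kernel_def[abs_def] by measurable
qed

text \<open>Cylinders over finitely many coordinates form an intersection-stable generator, and the
  mass of a cylinder is a finite product of measurable functions of \<open>s\<close>. The index set
  may be infinite, as the sequence behind \<open>Q_kernel\<close> demands.\<close>

lemma measurable_PiM_kernel:
  assumes K[measurable]: "\<And>i. i \<in> I \<Longrightarrow> K i \<in> S \<rightarrow>\<^sub>M prob_algebra (M i)"
  shows "(\<lambda>s. \<Pi>\<^sub>M i\<in>I. K i s) \<in> S \<rightarrow>\<^sub>M prob_algebra (\<Pi>\<^sub>M i\<in>I. M i)"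
proof (rule measurable_prob_algebra_generated[OF sets_PiM Int_stable_prod_algebra prod_algebra_sets_into_space])
  have K': "sets (K i s) = sets (M i)" "prob_space (K i s)" if "i \<in> I" "s \<in> space S" for i s
    using measurable_space[OF K[OF that(1)] that(2)] by (simp_all add: space_prob_algebra)
  show "prob_space (\<Pi>\<^sub>M i\<in>I. K i s)" if "s \<in> space S" for s
    using K' that by (intro prob_space_PiM) auto
  show "sets (\<Pi>\<^sub>M i\<in>I. K i s) = sets (\<Pi>\<^sub>M i\<in>I. M i)" if "s \<in> space S" for s
    using K' that by (intro sets_PiM_cong) auto
  fix A assume "A \<in> prod_algebra I M"
  then obtain J F where A: "A = prod_emb I M J (\<Pi>\<^sub>E j\<in>J. F j)"
    and J: "finite J" "J \<subseteq> I" and F: "\<And>i. i \<in> J \<Longrightarrow> F i \<in> sets (M i)"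
    by (rule prod_algebraE) (use that in blast)
  have "emeasure (\<Pi>\<^sub>M i\<in>I. K i s) A = (\<Prod>i\<in>J. emeasure (K i s) (F i))" if "s \<in> space S" for s
  proof -
    \<comment> \<open>The embedding of a cylinder refers to the underlying spaces; since these
      agree, the cylinder built from \<open>M\<close> is also the one built from
      \<open>K i s\<close>.\<close>
    have "(\<Pi>\<^sub>E i\<in>I. space (K i s)) = (\<Pi>\<^sub>E i\<in>I. space (M i))"
      by (intro PiE_cong sets_eq_imp_space_eq K' that)
    then have "A = prod_emb I (\<lambda>i. K i s) J (\<Pi>\<^sub>E j\<in>J. F j)"
      unfolding A prod_emb_def by simp
    moreover have "emeasure (\<Pi>\<^sub>M i\<in>I. K i s) (prod_emb I (\<lambda>i. K i s) J (\<Pi>\<^sub>E j\<in>J. F j)) =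
        (\<Prod>i\<in>J. emeasure (K i s) (F i))"
    proof (rule emeasure_PiM_emb)
      show "F i \<in> sets (K i s)" if "i \<in> J" for i
        using K'(1)[of i s] F[OF that] J that \<open>s \<in> space S\<close> by auto
    qed (use K' that J in auto)
    ultimately show ?thesis by simp
  qed
  moreover have "(\<lambda>s. \<Prod>i\<in>J. emeasure (K i s) (F i)) \<in> borel_measurable S"
    using J F by (intro borel_measurable_prod_ennreal
        measurable_compose[OF measurable_prob_algebraD[OF K] measurable_emeasure_subprob_algebra]) auto
  ultimately show "(\<lambda>s. emeasure (\<Pi>\<^sub>M i\<in>I. K i s) A) \<in> borel_measurable S"
    by (simp cong: measurable_cong)
qed

text \<open>The law of the whole sequence depends measurably on \<open>s\<close> by the product rule
  above, and \<open>Q_kernel\<close> is its image under a map that does not involve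
  \<open>s\<close>. Both arguments vary with \<open>s\<close> because in \<open>R_kernel\<close> the
  empirical measure and the starting point are functions of the same configuration.\<close>

lemma measurable_Q_kernel:
  fixes b :: "('d::finite) torus \<Rightarrow> real ^ 'd"
  assumes b: "b \<in> borel_measurable borel" and [measurable]: "lam \<in> borel_measurable borel"
    and [measurable]: "M \<in> S \<rightarrow>\<^sub>M prob_algebra borel" "f \<in> S \<rightarrow>\<^sub>M borel"
  shows "(\<lambda>s. Q_kernel b lam \<gamma> (M s) (f s)) \<in> S \<rightarrow>\<^sub>M prob_algebra borel"
proof -
  note [measurable] = measurable_euler_kernel[OF b, of \<gamma>]
  let ?U = "uniform_measure lborel {0..1::real}"
  let ?P = "\<Pi>\<^sub>M k\<in>(UNIV :: nat set). (borel :: 'd torus measure) \<Otimes>\<^sub>M (borel :: real measure)"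
  have U: "(\<lambda>_. ?U) \<in> S \<rightarrow>\<^sub>M prob_algebra borel"
    by (intro measurable_const) (auto simp: space_prob_algebra intro!: prob_space_uniform_measure)
  have M: "(\<lambda>s. M s \<bind> euler_kernel b \<gamma>) \<in> S \<rightarrow>\<^sub>M prob_algebra borel"
    by (rule measurable_bind_prob_space) measurable
  \<comment> \<open>The stopping index takes countably many values, so it suffices to treat each
    fixed coordinate. On sequences without an accepted index \<open>LEAST\<close> returns one fixed
    unspecified number, which preserves measurability.\<close>
  have L: "(\<lambda>\<omega>. fst (\<omega> (LEAST k. snd (\<omega> k) \<ge> kill_prob lam \<gamma> (fst (\<omega> k))))) \<in> ?P \<rightarrow>\<^sub>M borel"
    unfolding kill_prob_def
    by (rule measurable_compose_countable[where f="\<lambda>k \<omega>. fst (\<omega> k)"]) measurable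
  have "(\<lambda>s. \<Pi>\<^sub>M k\<in>(UNIV :: nat set).
      (if k = 0 then euler_kernel b \<gamma> (f s) else M s \<bind> euler_kernel b \<gamma>) \<Otimes>\<^sub>M ?U)
    \<in> S \<rightarrow>\<^sub>M prob_algebra ?P"
  proof (rule measurable_PiM_kernel)
    fix k :: nat
    have "(\<lambda>s. if k = 0 then euler_kernel b \<gamma> (f s) else M s \<bind> euler_kernel b \<gamma>) \<in> S \<rightarrow>\<^sub>M prob_algebra borel"
      using M by (cases "k = 0") simp_all
    from measurable_pair_prob[OF this U]
    show "(\<lambda>s. (if k = 0 then euler_kernel b \<gamma> (f s) else M s \<bind> euler_kernel b \<gamma>) \<Otimes>\<^sub>M ?U)
      \<in> S \<rightarrow>\<^sub>M prob_algebra (borel \<Otimes>\<^sub>M borel)" .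
  qed
  from measurable_compose[OF this measurable_distr_prob_space[OF L]]
  show ?thesis unfolding Q_kernel_def .
qed

text \<open>The empirical measure is the image of a fixed law on the indices under evaluation, and
  evaluation is jointly measurable because the index set is finite. The bound on \<open>N\<close>
  makes the uniform law a probability measure.\<close>

lemma measurable_empirical:
  assumes "1 \<le> N"
  shows "empirical N \<in> configs N \<rightarrow>\<^sub>M prob_algebra (borel :: ('d::finite) torus measure)"
proof -
  let ?C = "count_space {1..N}"
  have C: "uniform_count_measure {1..N} \<in> space (prob_algebra ?C)"
    using assms by (simp add: space_prob_algebra prob_space_uniform_count_measure sets_uniform_count_measure)
  have "(\<lambda>(x, i). x i) \<in> configs N \<Otimes>\<^sub>M ?C \<rightarrow>\<^sub>M (borel :: 'd torus measure)"
    unfolding configs_def case_prod_beta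
    by (rule measurable_compose_countable'[where f="\<lambda>i p. fst p i" and g=snd and I="{1..N}"]) auto
  then show ?thesis
    unfolding empirical_def[abs_def]
    by (rule measurable_distr_prob_space2[OF measurable_const[OF C]])
qed

lemma measurable_R_kernel:
  assumes "1 \<le> N" "b \<in> borel_measurable borel" "lam \<in> borel_measurable borel"
  shows "R_kernel b lam N \<gamma> \<in> configs N \<rightarrow>\<^sub>M prob_algebra (configs N)"
  unfolding R_kernel_def[abs_def] configs_def
  using measurable_empirical[OF assms(1), unfolded configs_def] assms
  by (intro measurable_PiM_kernel measurable_Q_kernel measurable_component_singleton) auto

subsection \<open>The triangle inequality for the Wasserstein distance\<close>

text \<open>The target measure of \<open>distr\<close> matters only through its \<sigma>-algebra.
  This lemma and the next translate between the marginals in \<open>couplings\<close> and marginals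
  over one common space \<open>S\<close>.\<close>

lemma couplingsD:
  assumes "\<xi> \<in> couplings \<mu> \<nu>" "sets \<mu> = sets S" "sets \<nu> = sets S"
  shows "prob_space \<xi>" "sets \<xi> = sets (S \<Otimes>\<^sub>M S)" "distr \<xi> S fst = \<mu>" "distr \<xi> S snd = \<nu>"
proof -
  have "sets (\<mu> \<Otimes>\<^sub>M \<nu>) = sets (S \<Otimes>\<^sub>M S)" using assms(2,3) by (rule sets_pair_measure_cong)
  with assms show "prob_space \<xi>" "sets \<xi> = sets (S \<Otimes>\<^sub>M S)" by (auto simp: couplings_def space_prob_algebra)
  have "distr \<xi> S fst = distr \<xi> \<mu> fst" "distr \<xi> S snd = distr \<xi> \<nu> snd"
    using assms(2,3) by (auto intro!: distr_cong)
  with assms(1) show "distr \<xi> S fst = \<mu>" "distr \<xi> S snd = \<nu>" by (auto simp: couplings_def)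
qed

lemma couplingsI:
  assumes "prob_space \<xi>" "sets \<xi> = sets (S \<Otimes>\<^sub>M S)" "distr \<xi> S fst = \<mu>" "distr \<xi> S snd = \<nu>"
  shows "\<xi> \<in> couplings \<mu> \<nu>"
proof -
  have S: "sets \<mu> = sets S" "sets \<nu> = sets S" using assms(3,4) by auto
  then have "sets (\<mu> \<Otimes>\<^sub>M \<nu>) = sets (S \<Otimes>\<^sub>M S)" by (rule sets_pair_measure_cong)
  moreover have "distr \<xi> S fst = distr \<xi> \<mu> fst" "distr \<xi> S snd = distr \<xi> \<nu> snd"
    using S by (auto intro!: distr_cong)
  ultimately show ?thesis using assms by (simp add: couplings_def space_prob_algebra)
qed

text \<open>The product measure is a coupling. Nonemptiness is what gives the real infimum in
  \<open>wasserstein\<close> its meaning and provides near-minimisers.\<close>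

lemma couplings_nonempty:
  assumes \<mu>: "\<mu> \<in> space (prob_algebra S)" and \<nu>: "\<nu> \<in> space (prob_algebra S)"
  shows "couplings \<mu> \<nu> \<noteq> {}"
proof -
  from assms have s: "sets \<mu> = sets S" "sets \<nu> = sets S" and "prob_space \<mu>" "prob_space \<nu>"
    by (auto simp: space_prob_algebra)
  interpret \<mu>: prob_space \<mu> by fact
  interpret \<nu>: prob_space \<nu> by fact
  interpret pair_prob_space \<mu> \<nu> ..
  have "\<mu> \<Otimes>\<^sub>M \<nu> \<in> couplings \<mu> \<nu>"
  proof -
    have "distr (\<mu> \<Otimes>\<^sub>M \<nu>) \<mu> fst = \<mu>" by (rule \<nu>.distr_pair_fst)
    moreover have "distr (\<mu> \<Otimes>\<^sub>M \<nu>) \<nu> snd = \<nu>"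
    proof (rule measure_eqI)
      fix A assume "A \<in> sets (distr (\<mu> \<Otimes>\<^sub>M \<nu>) \<nu> snd)"
      then have A: "A \<in> sets \<nu>" by simp
      have "snd -` A \<inter> space (\<mu> \<Otimes>\<^sub>M \<nu>) = space \<mu> \<times> A"
        using sets.sets_into_space[OF A] by (auto simp: space_pair_measure)
      with A show "emeasure (distr (\<mu> \<Otimes>\<^sub>M \<nu>) \<nu> snd) A = emeasure \<nu> A"
        by (simp add: emeasure_distr \<nu>.emeasure_pair_measure_Times \<mu>.emeasure_space_1)
    qed simp
    ultimately show ?thesis
      by (simp add: couplings_def space_prob_algebra P.prob_space_axioms)
  qed
  then show ?thesis by blast
qed

lemma wasserstein_upper:
  assumes "\<And>x y. 0 \<le> r x y" "\<xi> \<in> couplings \<mu> \<nu>"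
  shows "wasserstein r \<mu> \<nu> \<le> (\<integral>z. r (fst z) (snd z) \<partial>\<xi>)"
  unfolding wasserstein_def using assms
  by (intro cINF_lower bdd_belowI[of _ 0]) auto

lemma wasserstein_approx:
  assumes "\<mu> \<in> space (prob_algebra S)" "\<nu> \<in> space (prob_algebra S)" "0 < e"
  obtains \<xi> where "\<xi> \<in> couplings \<mu> \<nu>" "(\<integral>z. r (fst z) (snd z) \<partial>\<xi>) < wasserstein r \<mu> \<nu> + e"
proof -
  have "(INF \<xi>\<in>couplings \<mu> \<nu>. \<integral>z. r (fst z) (snd z) \<partial>\<xi>) < wasserstein r \<mu> \<nu> + e"
    using \<open>0 < e\<close> by (simp add: wasserstein_def)
  from cInf_lessD[OF _ this] couplings_nonempty[OF assms(1,2)] that show thesis by auto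
qed

text \<open>There are only countably many cells, so the union of those of mass zero is null. In a
  cell of positive mass the weight is the reciprocal of the mass and integrates to 1 over the
  cell.\<close>

lemma nn_integral_cell_weight:
  fixes c :: "'a \<Rightarrow> 'c::countable"
  assumes "prob_space \<nu>" "c \<in> \<nu> \<rightarrow>\<^sub>M count_space UNIV"
  shows "AE y in \<nu>. (\<integral>\<^sup>+y'. (if c y = c y' then ennreal (inverse (measure \<nu> {z \<in> space \<nu>. c z = c y})) else 0) \<partial>\<nu>) = 1"
proof -
  interpret prob_space \<nu> by fact
  note [measurable] = assms(2)
  have "AE y in \<nu>. \<forall>k. measure \<nu> {z \<in> space \<nu>. c z = k} = 0 \<longrightarrow> c y \<noteq> k"
    unfolding AE_all_countable
  proof
    fix k
    show "AE y in \<nu>. measure \<nu> {z \<in> space \<nu>. c z = k} = 0 \<longrightarrow> c y \<noteq> k"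
      by (cases "measure \<nu> {z \<in> space \<nu>. c z = k} = 0")
        (auto simp: emeasure_eq_measure intro!: AE_I[where N="{z \<in> space \<nu>. c z = k}"])
  qed
  then show ?thesis
  proof (rule AE_mp, intro AE_I2 impI)
    fix y
    let ?m = "measure \<nu> {z \<in> space \<nu>. c z = c y}"
    assume "\<forall>k. measure \<nu> {z \<in> space \<nu>. c z = k} = 0 \<longrightarrow> c y \<noteq> k"
    then have m: "?m \<noteq> 0" by auto
    have "(\<integral>\<^sup>+y'. (if c y = c y' then ennreal (inverse ?m) else 0) \<partial>\<nu>) =
       (\<integral>\<^sup>+y'. ennreal (inverse ?m) * indicator {z \<in> space \<nu>. c z = c y} y' \<partial>\<nu>)"
      by (intro nn_integral_cong) (auto simp: indicator_def)
    also have "\<dots> = ennreal (inverse ?m) * emeasure \<nu> {z \<in> space \<nu>. c z = c y}"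
      by (intro nn_integral_cmult_indicator) measurable
    also have "\<dots> = 1"
      using m by (simp add: emeasure_eq_measure ennreal_mult[symmetric])
    finally show "(\<integral>\<^sup>+y'. (if c y = c y' then ennreal (inverse ?m) else 0) \<partial>\<nu>) = 1" .
  qed
qed

text \<open>
  The glued coupling is the image of the measure with density \<open>1 / \<nu>(cell)\<close> on the pairs
  \<open>((x, y), (y', z))\<close> whose middle points lie in the same cell.
\<close>
lemma couplings_glue_approx:
  fixes c :: "'a \<Rightarrow> 'c::countable" and r :: "'a \<Rightarrow> 'a \<Rightarrow> real"
  assumes S: "\<mu> \<in> space (prob_algebra S)" "\<nu> \<in> space (prob_algebra S)" "\<eta> \<in> space (prob_algebra S)"
    and \<xi>: "\<xi>\<^sub>1 \<in> couplings \<mu> \<nu>" "\<xi>\<^sub>2 \<in> couplings \<nu> \<eta>"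
    and c[measurable]: "c \<in> S \<rightarrow>\<^sub>M count_space UNIV"
    and r[measurable]: "(\<lambda>z. r (fst z) (snd z)) \<in> borel_measurable (S \<Otimes>\<^sub>M S)"
    and nn: "\<And>x y. 0 \<le> r x y" and "0 \<le> e"
    and cell: "\<And>x y y' z. c y = c y' \<Longrightarrow> r x z \<le> r x y + e + r y' z"
  obtains \<xi> where "\<xi> \<in> couplings \<mu> \<eta>"
    "(\<integral>\<^sup>+z. r (fst z) (snd z) \<partial>\<xi>) \<le> (\<integral>\<^sup>+z. r (fst z) (snd z) \<partial>\<xi>\<^sub>1) + ennreal e + (\<integral>\<^sup>+z. r (fst z) (snd z) \<partial>\<xi>\<^sub>2)"
proof -
  from S have s: "sets \<mu> = sets S" "sets \<nu> = sets S" "sets \<eta> = sets S" and "prob_space \<nu>"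
    by (auto simp: space_prob_algebra)
  note c1 = couplingsD[OF \<xi>(1) s(1,2)] and c2 = couplingsD[OF \<xi>(2) s(2,3)]
  note [measurable_cong] = c1(2) c2(2)
  have sp1: "space \<xi>\<^sub>1 = space S \<times> space S" and sp2: "space \<xi>\<^sub>2 = space S \<times> space S"
    using sets_eq_imp_space_eq[OF c1(2)] sets_eq_imp_space_eq[OF c2(2)] by (simp_all add: space_pair_measure)
  interpret X1: prob_space \<xi>\<^sub>1 by (rule c1)
  interpret X2: prob_space \<xi>\<^sub>2 by (rule c2)
  interpret pair_prob_space \<xi>\<^sub>1 \<xi>\<^sub>2 ..
  define m where "m k = inverse (measure \<nu> {z \<in> space \<nu>. c z = k})" for k
  define w where "w y y' = (if c y = c y' then ennreal (m (c y)) else 0)" for y y'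
  have w_sym: "w y y' = w y' y" for y y' by (simp add: w_def)
  have w_meas[measurable]: "(\<lambda>z. w (f z) (g z)) \<in> borel_measurable M"
    if [measurable]: "f \<in> M \<rightarrow>\<^sub>M S" "g \<in> M \<rightarrow>\<^sub>M S" for M :: "'z measure" and f g
    unfolding w_def by measurable
  \<comment> \<open>For fixed \<open>y\<close> only the law of \<open>h\<close> matters. It is
    applied to the middle coordinate of either coupling, whose law is \<nu>.\<close>
  have w_int: "(\<integral>\<^sup>+q. w y (h q) * k \<partial>M) = (\<integral>\<^sup>+y'. w y y' \<partial>distr M S h) * k"
    if h: "h \<in> M \<rightarrow>\<^sub>M S" and y: "y \<in> space S" for M :: "'z measure" and h y k
  proof -
    have wy: "w y \<in> borel_measurable S"
      using w_meas[OF measurable_const[OF y] measurable_ident] by (simp add: id_def)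
    have "(\<integral>\<^sup>+q. w y (h q) * k \<partial>M) = (\<integral>\<^sup>+q. w y (h q) \<partial>M) * k"
      by (rule nn_integral_multc[OF measurable_compose[OF h wy]])
    also have "(\<integral>\<^sup>+q. w y (h q) \<partial>M) = (\<integral>\<^sup>+y'. w y y' \<partial>distr M S h)"
      by (rule nn_integral_distr[OF h, symmetric]) (simp add: wy)
    finally show ?thesis .
  qed
  have c\<nu>: "c \<in> \<nu> \<rightarrow>\<^sub>M count_space UNIV" using c s(2) by (simp cong: measurable_cong_sets)
  have w1: "AE y in \<nu>. (\<integral>\<^sup>+y'. w y y' \<partial>\<nu>) = 1"
    using nn_integral_cell_weight[OF \<open>prob_space \<nu>\<close> c\<nu>] unfolding w_def m_def .
  \<comment> \<open>The normalisation holds for \<nu>-almost every point, hence for almost every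
    pair of either coupling, because the middle marginal of both is \<nu>.\<close>
  have "AE y in distr \<xi>\<^sub>1 S snd. (\<integral>\<^sup>+y'. w y y' \<partial>\<nu>) = 1" unfolding c1(4) by (rule w1)
  then have w11: "AE p in \<xi>\<^sub>1. (\<integral>\<^sup>+y'. w (snd p) y' \<partial>\<nu>) = 1" by (rule AE_distrD[rotated]) measurable
  have "AE y in distr \<xi>\<^sub>2 S fst. (\<integral>\<^sup>+y'. w y y' \<partial>\<nu>) = 1" unfolding c2(3) by (rule w1)
  then have w12: "AE q in \<xi>\<^sub>2. (\<integral>\<^sup>+y'. w (fst q) y' \<partial>\<nu>) = 1" by (rule AE_distrD[rotated]) measurable
  let ?W = "\<lambda>z. w (snd (fst z)) (fst (snd z))"
  define G where "G = density (\<xi>\<^sub>1 \<Otimes>\<^sub>M \<xi>\<^sub>2) ?W"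
  have sG[measurable_cong]: "sets G = sets ((S \<Otimes>\<^sub>M S) \<Otimes>\<^sub>M (S \<Otimes>\<^sub>M S))"
    unfolding G_def sets_density by (rule sets_pair_measure_cong[OF c1(2) c2(2)])
  \<comment> \<open>Integrating out the second pair first leaves the total weight of a cell, which
    is 1 almost everywhere. Thus the first pair keeps the law \<open>\<xi>\<^sub>1\<close> exactly
    under \<open>G\<close>.\<close>
  have G1: "(\<integral>\<^sup>+z. f (fst z) \<partial>G) = (\<integral>\<^sup>+p. f p \<partial>\<xi>\<^sub>1)"
    if f[measurable]: "f \<in> borel_measurable (S \<Otimes>\<^sub>M S)" for f
  proof -
    have Wf: "(\<lambda>z. ?W z * f (fst z)) \<in> borel_measurable (\<xi>\<^sub>1 \<Otimes>\<^sub>M \<xi>\<^sub>2)"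
      by measurable
    have "(\<integral>\<^sup>+z. f (fst z) \<partial>G) = (\<integral>\<^sup>+z. ?W z * f (fst z) \<partial>(\<xi>\<^sub>1 \<Otimes>\<^sub>M \<xi>\<^sub>2))"
      unfolding G_def by (rule nn_integral_density) measurable
    also have "\<dots> = (\<integral>\<^sup>+p. \<integral>\<^sup>+q. w (snd p) (fst q) * f p \<partial>\<xi>\<^sub>2 \<partial>\<xi>\<^sub>1)"
      using X2.nn_integral_fst[OF Wf, symmetric] unfolding fst_conv snd_conv .
    also have "\<dots> = (\<integral>\<^sup>+p. f p \<partial>\<xi>\<^sub>1)"
    proof (rule nn_integral_cong_AE, use w11 AE_space in eventually_elim)
      fix p assume p: "(\<integral>\<^sup>+y'. w (snd p) y' \<partial>\<nu>) = 1" and "p \<in> space \<xi>\<^sub>1"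
      from this(2) have p0: "snd p \<in> space S"
        unfolding sp1 mem_Times_iff by (rule conjunct2)
      have "fst \<in> \<xi>\<^sub>2 \<rightarrow>\<^sub>M S" by measurable
      from w_int[OF this p0] show "(\<integral>\<^sup>+q. w (snd p) (fst q) * f p \<partial>\<xi>\<^sub>2) = f p"
        unfolding c2(3) p by simp
    qed
    finally show ?thesis .
  qed
  \<comment> \<open>The same computation in the other order of integration; the symmetry of
    \<open>w\<close> lets the weight be integrated over the other middle point.\<close>
  have G2: "(\<integral>\<^sup>+z. f (snd z) \<partial>G) = (\<integral>\<^sup>+q. f q \<partial>\<xi>\<^sub>2)"
    if f[measurable]: "f \<in> borel_measurable (S \<Otimes>\<^sub>M S)" for f
  proof -
    have Wf: "(\<lambda>z. ?W z * f (snd z)) \<in> borel_measurable (\<xi>\<^sub>1 \<Otimes>\<^sub>M \<xi>\<^sub>2)"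
      by measurable
    have "(\<integral>\<^sup>+z. f (snd z) \<partial>G) = (\<integral>\<^sup>+z. ?W z * f (snd z) \<partial>(\<xi>\<^sub>1 \<Otimes>\<^sub>M \<xi>\<^sub>2))"
      unfolding G_def by (rule nn_integral_density) measurable
    also have "\<dots> = (\<integral>\<^sup>+q. \<integral>\<^sup>+p. w (snd p) (fst q) * f q \<partial>\<xi>\<^sub>1 \<partial>\<xi>\<^sub>2)"
      using nn_integral_snd[OF Wf, symmetric] unfolding fst_conv snd_conv .
    also have "\<dots> = (\<integral>\<^sup>+q. f q \<partial>\<xi>\<^sub>2)"
    proof (rule nn_integral_cong_AE, use w12 AE_space in eventually_elim)
      fix q assume q: "(\<integral>\<^sup>+y'. w (fst q) y' \<partial>\<nu>) = 1" and "q \<in> space \<xi>\<^sub>2"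
      from this(2) have q0: "fst q \<in> space S"
        unfolding sp2 mem_Times_iff by (rule conjunct1)
      have "snd \<in> \<xi>\<^sub>1 \<rightarrow>\<^sub>M S" by measurable
      from w_int[OF this q0] show "(\<integral>\<^sup>+p. w (snd p) (fst q) * f q \<partial>\<xi>\<^sub>1) = f q"
        unfolding w_sym[of _ "fst q"] c1(4) q by simp
    qed
    finally show ?thesis .
  qed
  define g where "g = (\<lambda>z :: ('a \<times> 'a) \<times> 'a \<times> 'a. (fst (fst z), snd (snd z)))"
  have g[measurable]: "g \<in> G \<rightarrow>\<^sub>M S \<Otimes>\<^sub>M S" unfolding g_def by measurable
  have G_prob: "prob_space G"
  proof
    show "emeasure G (space G) = 1"
      using G1[of "\<lambda>_. 1"] by (simp add: X1.emeasure_space_1)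
  qed
  show thesis
  proof (rule that)
    show "distr G (S \<Otimes>\<^sub>M S) g \<in> couplings \<mu> \<eta>"
    proof (rule couplingsI)
      show "prob_space (distr G (S \<Otimes>\<^sub>M S) g)" using G_prob g by (rule prob_space.prob_space_distr)
      show "distr (distr G (S \<Otimes>\<^sub>M S) g) S fst = \<mu>"
      proof (rule measure_eqI)
        fix A assume "A \<in> sets (distr (distr G (S \<Otimes>\<^sub>M S) g) S fst)"
        then have [measurable]: "A \<in> sets S" by simp
        have "emeasure (distr (distr G (S \<Otimes>\<^sub>M S) g) S fst) A = (\<integral>\<^sup>+z. indicator A (fst (fst z)) \<partial>G)"
          by (simp add: nn_integral_indicator[symmetric] nn_integral_distr g_def del: nn_integral_indicator)
        also have "\<dots> = (\<integral>\<^sup>+p. indicator A (fst p) \<partial>\<xi>\<^sub>1)"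
          by (rule G1) measurable
        also have "\<dots> = emeasure (distr \<xi>\<^sub>1 S fst) A"
          by (simp add: nn_integral_indicator[symmetric] nn_integral_distr del: nn_integral_indicator)
        finally show "emeasure (distr (distr G (S \<Otimes>\<^sub>M S) g) S fst) A = emeasure \<mu> A"
          by (simp add: c1(3))
      qed (simp add: s)
      show "distr (distr G (S \<Otimes>\<^sub>M S) g) S snd = \<eta>"
      proof (rule measure_eqI)
        fix A assume "A \<in> sets (distr (distr G (S \<Otimes>\<^sub>M S) g) S snd)"
        then have [measurable]: "A \<in> sets S" by simp
        have "emeasure (distr (distr G (S \<Otimes>\<^sub>M S) g) S snd) A = (\<integral>\<^sup>+z. indicator A (snd (snd z)) \<partial>G)"
          by (simp add: nn_integral_indicator[symmetric] nn_integral_distr g_def del: nn_integral_indicator)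
        also have "\<dots> = (\<integral>\<^sup>+q. indicator A (snd q) \<partial>\<xi>\<^sub>2)"
          by (rule G2) measurable
        also have "\<dots> = emeasure (distr \<xi>\<^sub>2 S snd) A"
          by (simp add: nn_integral_indicator[symmetric] nn_integral_distr del: nn_integral_indicator)
        finally show "emeasure (distr (distr G (S \<Otimes>\<^sub>M S) g) S snd) A = emeasure \<eta> A"
          by (simp add: c2(4))
      qed (simp add: s)
    qed simp
    let ?r = "\<lambda>z. ennreal (r (fst z) (snd z))"
    have "(\<integral>\<^sup>+z. ?r z \<partial>distr G (S \<Otimes>\<^sub>M S) g) = (\<integral>\<^sup>+z. ?r (g z) \<partial>G)"
      by (rule nn_integral_distr) measurable
    also have "\<dots> = (\<integral>\<^sup>+z. ?W z * ?r (g z) \<partial>(\<xi>\<^sub>1 \<Otimes>\<^sub>M \<xi>\<^sub>2))"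
      unfolding G_def by (rule nn_integral_density) (unfold g_def, measurable)
    \<comment> \<open>Keeping the weight inside the integral restricts the comparison to pairs whose
      middle points share a cell, the only place where \<open>cell\<close> applies.\<close>
    also have "\<dots> \<le> (\<integral>\<^sup>+z. ?W z * (?r (fst z) + ennreal e + ?r (snd z)) \<partial>(\<xi>\<^sub>1 \<Otimes>\<^sub>M \<xi>\<^sub>2))"
    proof (rule nn_integral_mono)
      fix z
      show "?W z * ?r (g z) \<le> ?W z * (?r (fst z) + ennreal e + ?r (snd z))"
      proof (cases "c (snd (fst z)) = c (fst (snd z))")
        case True
        from cell[OF this, of "fst (fst z)" "snd (snd z)"]
        have "?r (g z) \<le> ennreal (r (fst (fst z)) (snd (fst z)) + e + r (fst (snd z)) (snd (snd z)))"
          by (intro ennreal_leI) (simp add: g_def)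
        also have "\<dots> = ?r (fst z) + ennreal e + ?r (snd z)"
          using nn \<open>0 \<le> e\<close> by simp
        finally show ?thesis by (rule mult_left_mono) simp
      qed (simp add: w_def)
    qed
    also have "\<dots> = (\<integral>\<^sup>+z. (?r (fst z) + ennreal e + ?r (snd z)) \<partial>G)"
      unfolding G_def by (rule nn_integral_density[symmetric]) measurable
    also have "\<dots> = (\<integral>\<^sup>+z. ?r (fst z) \<partial>G) + (\<integral>\<^sup>+z. ennreal e \<partial>G) + (\<integral>\<^sup>+z. ?r (snd z) \<partial>G)"
      by (simp add: nn_integral_add)
    also have "\<dots> = (\<integral>\<^sup>+z. ?r z \<partial>\<xi>\<^sub>1) + ennreal e + (\<integral>\<^sup>+z. ?r z \<partial>\<xi>\<^sub>2)"
      by (simp add: G1[of ?r] G2[of ?r] prob_space.emeasure_space_1[OF G_prob])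
    finally show "(\<integral>\<^sup>+z. ?r z \<partial>distr G (S \<Otimes>\<^sub>M S) g) \<le> \<dots>" .
  qed
qed

text \<open>The error \<open>e\<close> is spent in thirds: one for each of the two near-minimal
  couplings and one for the diameter of the cells used to glue them.\<close>

lemma wasserstein_triangle:
  fixes r :: "'a \<Rightarrow> 'a \<Rightarrow> real"
  assumes S: "\<mu> \<in> space (prob_algebra S)" "\<nu> \<in> space (prob_algebra S)" "\<eta> \<in> space (prob_algebra S)"
    and r[measurable]: "(\<lambda>z. r (fst z) (snd z)) \<in> borel_measurable (S \<Otimes>\<^sub>M S)"
    and nn: "\<And>x y. 0 \<le> r x y" and bdd: "\<And>x y. r x y \<le> C"
    and triangle: "\<And>x y z. r x z \<le> r x y + r y z"
    and cells: "\<And>e. 0 < e \<Longrightarrow> \<exists>c :: 'a \<Rightarrow> 'c::countable.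
      c \<in> S \<rightarrow>\<^sub>M count_space UNIV \<and> (\<forall>y y'. c y = c y' \<longrightarrow> r y y' \<le> e)"
  shows "wasserstein r \<mu> \<eta> \<le> wasserstein r \<mu> \<nu> + wasserstein r \<nu> \<eta>"
proof (rule field_le_epsilon)
  fix e :: real assume "0 < e"
  then have e: "0 < e / 3" by simp
  from S have s: "sets \<mu> = sets S" "sets \<nu> = sets S" "sets \<eta> = sets S"
    by (auto simp: space_prob_algebra)
  from cells[OF e] obtain c :: "'a \<Rightarrow> 'c" where c: "c \<in> S \<rightarrow>\<^sub>M count_space UNIV"
    "\<And>y y'. c y = c y' \<Longrightarrow> r y y' \<le> e / 3" by blast
  obtain \<xi>\<^sub>1 where \<xi>1: "\<xi>\<^sub>1 \<in> couplings \<mu> \<nu>" "(\<integral>z. r (fst z) (snd z) \<partial>\<xi>\<^sub>1) < wasserstein r \<mu> \<nu> + e / 3"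
    by (rule wasserstein_approx[OF S(1,2) e])
  obtain \<xi>\<^sub>2 where \<xi>2: "\<xi>\<^sub>2 \<in> couplings \<nu> \<eta>" "(\<integral>z. r (fst z) (snd z) \<partial>\<xi>\<^sub>2) < wasserstein r \<nu> \<eta> + e / 3"
    by (rule wasserstein_approx[OF S(2,3) e])
  \<comment> \<open>Two triangle inequalities, passing through \<open>y\<close> and then
    \<open>y'\<close>; the middle cost is bounded by the diameter of the cell.\<close>
  have cell: "r x z \<le> r x y + e / 3 + r y' z" if "c y = c y'" for x y y' z
    using triangle[of x z y] triangle[of y z y'] c(2)[OF that] by linarith
  obtain \<xi> where \<xi>: "\<xi> \<in> couplings \<mu> \<eta>"
    "(\<integral>\<^sup>+z. r (fst z) (snd z) \<partial>\<xi>) \<le> (\<integral>\<^sup>+z. r (fst z) (snd z) \<partial>\<xi>\<^sub>1) + ennreal (e / 3) + (\<integral>\<^sup>+z. r (fst z) (snd z) \<partial>\<xi>\<^sub>2)"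
    by (rule couplings_glue_approx[OF S \<xi>1(1) \<xi>2(1) c(1) r nn less_imp_le[OF e] cell])
  \<comment> \<open>Gluing is carried out with nonnegative integrals, whereas
    \<open>wasserstein\<close> uses Bochner integrals. Boundedness of the cost makes it integrable
    under every coupling, so the two agree.\<close>
  have nn_eq: "(\<integral>\<^sup>+z. r (fst z) (snd z) \<partial>\<zeta>) = ennreal (\<integral>z. r (fst z) (snd z) \<partial>\<zeta>)"
    if "\<zeta> \<in> couplings \<alpha> \<beta>" "sets \<alpha> = sets S" "sets \<beta> = sets S" for \<zeta> \<alpha> \<beta>
  proof -
    note \<zeta> = couplingsD[OF that]
    interpret \<zeta>: prob_space \<zeta> by (rule \<zeta>)
    note [measurable_cong] = \<zeta>(2)
    show ?thesis using nn bdd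
      by (intro nn_integral_eq_integral \<zeta>.integrable_const_bound[of _ C]) auto
  qed
  have int_nn: "0 \<le> (\<integral>z. r (fst z) (snd z) \<partial>\<zeta>)" for \<zeta> using nn by (intro Bochner_Integration.integral_nonneg) auto
  have "(\<integral>z. r (fst z) (snd z) \<partial>\<xi>) \<le> (\<integral>z. r (fst z) (snd z) \<partial>\<xi>\<^sub>1) + e / 3 + (\<integral>z. r (fst z) (snd z) \<partial>\<xi>\<^sub>2)"
  proof -
    have "ennreal (\<integral>z. r (fst z) (snd z) \<partial>\<xi>)
        \<le> ennreal (\<integral>z. r (fst z) (snd z) \<partial>\<xi>\<^sub>1) + ennreal (e / 3) + ennreal (\<integral>z. r (fst z) (snd z) \<partial>\<xi>\<^sub>2)"
      using \<xi>(2) unfolding nn_eq[OF \<xi>(1) s(1,3)] nn_eq[OF \<xi>1(1) s(1,2)] nn_eq[OF \<xi>2(1) s(2,3)] .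
    also have "\<dots> = ennreal ((\<integral>z. r (fst z) (snd z) \<partial>\<xi>\<^sub>1) + e / 3 + (\<integral>z. r (fst z) (snd z) \<partial>\<xi>\<^sub>2))"
      using int_nn[of \<xi>\<^sub>1] int_nn[of \<xi>\<^sub>2] e by (subst ennreal_plus; simp)+
    finally show ?thesis
      using int_nn[of \<xi>\<^sub>1] int_nn[of \<xi>\<^sub>2] e by (subst (asm) ennreal_le_iff) linarith+
  qed
  with wasserstein_upper[of r, OF nn \<xi>(1)] \<xi>1(2) \<xi>2(2)
  show "wasserstein r \<mu> \<eta> \<le> wasserstein r \<mu> \<nu> + wasserstein r \<nu> \<eta> + e" by simp
qed

subsection \<open>Truncated distances on configurations\<close>

lemma rho_nonneg: "0 < a \<Longrightarrow> 0 \<le> rho a x y"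
  by (simp add: rho_def)

lemma rho_le_inverse: "0 < a \<Longrightarrow> rho a x y \<le> inverse a"
  by (simp add: rho_def field_simps)

lemma rho_le_dist: "0 < a \<Longrightarrow> rho a x y \<le> dist x y"
  using exp_ge_add_one_self[of "- a * dist x y"] by (simp add: rho_def field_simps)

text \<open>With \<open>?u\<close> and \<open>?v\<close> in [0, 1], the inequality
  \<open>1 - ?u * ?v \<le> (1 - ?u) + (1 - ?v)\<close> is just
  \<open>0 \<le> (1 - ?u) * (1 - ?v)\<close>.\<close>

lemma rho_triangle:
  assumes "0 < a"
  shows "rho a x z \<le> rho a x y + rho a y z"
proof -
  let ?u = "exp (- a * dist x y)" and ?v = "exp (- a * dist y z)"
  have "?u * ?v \<le> exp (- a * dist x z)"
    using mult_left_mono[OF dist_triangle[of x z y], of a] assms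
    by (simp add: exp_add[symmetric] distrib_left)
  moreover have "0 \<le> (1 - ?u) * (1 - ?v)"
    using assms by (intro mult_nonneg_nonneg) auto
  ultimately have "1 - exp (- a * dist x z) \<le> (1 - ?u) + (1 - ?v)" by (simp add: algebra_simps)
  with assms show ?thesis
    by (simp add: rho_def add_divide_distrib[symmetric] divide_right_mono)
qed

text \<open>Each coordinate is labelled by the first point of a dense sequence within
  \<open>e / 2\<close> of it; equal labels mean a common centre, hence distance below
  \<open>e\<close>. The list of the labels is the cell.\<close>

lemma configs_countable_partition:
  assumes "0 < e"
  obtains c :: "(nat \<Rightarrow> ('d::finite) torus) \<Rightarrow> nat list"
  where "c \<in> configs N \<rightarrow>\<^sub>M count_space UNIV"
    and "\<And>y y' i. c y = c y' \<Longrightarrow> i \<in> {1..N} \<Longrightarrow> dist (y i) (y' i) < e"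
proof -
  obtain q :: "nat \<Rightarrow> 'd torus" where q: "\<And>x e. 0 < e \<Longrightarrow> \<exists>k. dist x (q k) < e"
    using torus_dense_sequence by blast
  define c0 where "c0 x = (LEAST k. dist x (q k) < e / 2)" for x
  have c0: "dist x (q (c0 x)) < e / 2" for x
    unfolding c0_def by (rule LeastI_ex[OF q]) (use assms in simp)
  have c0_meas: "c0 \<in> borel \<rightarrow>\<^sub>M count_space UNIV" unfolding c0_def by measurable
  \<comment> \<open>Arbitrary index lists allow an induction: the head label takes countably many
    values, so it can be held fixed while the tail is handled by the induction hypothesis.\<close>
  have c_meas: "(\<lambda>y. map (\<lambda>i. c0 (y i)) is) \<in> configs N \<rightarrow>\<^sub>M count_space UNIV" if "set is \<subseteq> {1..N}" for "is"
    using that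
  proof (induction "is")
    case (Cons i "is")
    have "(\<lambda>y. c0 (y i)) \<in> configs N \<rightarrow>\<^sub>M count_space UNIV"
      unfolding configs_def using Cons.prems
      by (intro measurable_compose[OF _ c0_meas] measurable_component_singleton) auto
    moreover have "(\<lambda>y. k # map (\<lambda>i. c0 (y i)) is) \<in> configs N \<rightarrow>\<^sub>M count_space UNIV" for k
      using Cons by (intro measurable_compose[OF Cons.IH]) auto
    ultimately show ?case
      unfolding list.map by (rule measurable_compose_countable[rotated])
  qed simp
  have "(\<lambda>y. map (\<lambda>i. c0 (y i)) [1..<Suc N]) \<in> configs N \<rightarrow>\<^sub>M count_space UNIV"
    by (rule c_meas) (auto simp del: upt_Suc)
  moreover have "dist (y i) (y' i) < e"
    if "map (\<lambda>i. c0 (y i)) [1..<Suc N] = map (\<lambda>i. c0 (y' i)) [1..<Suc N]" "i \<in> {1..N}"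
    for y y' :: "nat \<Rightarrow> 'd torus" and i
  proof -
    have "c0 (y i) = c0 (y' i)" using that by (auto simp del: upt_Suc)
    with c0[of "y i"] c0[of "y' i"] show ?thesis
      using dist_triangle2[of "y i" "y' i" "q (c0 (y i))"] by simp
  qed
  ultimately show thesis by (rule that)
qed

lemma wasserstein_rho_N_triangle:
  assumes "0 < a" "1 \<le> N"
    and S: "\<mu> \<in> space (prob_algebra (configs N))" "\<nu> \<in> space (prob_algebra (configs N))"
      "\<eta> \<in> space (prob_algebra (configs N :: (nat \<Rightarrow> ('d::finite) torus) measure))"
  shows "wasserstein (rho_N a N) \<mu> \<eta> \<le> wasserstein (rho_N a N) \<mu> \<nu> + wasserstein (rho_N a N) \<nu> \<eta>"
proof (rule wasserstein_triangle[OF S])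
  show "(\<lambda>z. rho_N a N (fst z) (snd z)) \<in> borel_measurable (configs N \<Otimes>\<^sub>M configs N)"
    unfolding rho_N_def rho_def configs_def by measurable
  show "0 \<le> rho_N a N x y" for x y
    unfolding rho_N_def using assms by (intro sum_nonneg rho_nonneg)
  show "rho_N a N x y \<le> real N * inverse a" for x y
    unfolding rho_N_def using sum_bounded_above[of "{1..N}", OF rho_le_inverse[OF \<open>0 < a\<close>]] by simp
  show "rho_N a N x z \<le> rho_N a N x y + rho_N a N y z" for x y z
    unfolding rho_N_def sum.distrib[symmetric] using assms by (intro sum_mono rho_triangle)
  fix e :: real assume "0 < e"
  \<comment> \<open>Each of the \<open>N\<close> coordinates may contribute \<open>e / N\<close>,
    since \<open>rho\<close> is at most the distance.\<close>
  then have "0 < e / N" using assms by simp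
  from configs_countable_partition[OF this, of N] obtain c :: "(nat \<Rightarrow> 'd torus) \<Rightarrow> nat list"
    where c: "c \<in> configs N \<rightarrow>\<^sub>M count_space UNIV"
      "\<And>y y' i. c y = c y' \<Longrightarrow> i \<in> {1..N} \<Longrightarrow> dist (y i) (y' i) < e / N"
    by blast
  have "rho_N a N y y' \<le> e" if "c y = c y'" for y y'
  proof -
    have "rho_N a N y y' \<le> (\<Sum>i=1..N. e / N)"
      unfolding rho_N_def
      by (intro sum_mono order_trans[OF rho_le_dist[OF \<open>0 < a\<close>]] less_imp_le c(2) that)
    then show ?thesis using assms by simp
  qed
  with c(1) show "\<exists>c :: (nat \<Rightarrow> 'd torus) \<Rightarrow> nat list.
      c \<in> configs N \<rightarrow>\<^sub>M count_space UNIV \<and> (\<forall>y y'. c y = c y' \<longrightarrow> rho_N a N y y' \<le> e)" by blast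
qed

section \<open>Comparison of the two invariant measures\<close>

theorem corollary16:
  fixes b :: "('d::finite) torus \<Rightarrow> real ^ 'd"
    and lam :: "'d torus \<Rightarrow> real"
    and L c1 a \<gamma>0 c2 C5 :: real
    and \<Omega> :: "'w measure"
    and E :: "nat \<Rightarrow> nat \<Rightarrow> nat \<Rightarrow> 'w \<Rightarrow> real"
    and B :: "nat \<Rightarrow> nat \<Rightarrow> nat \<Rightarrow> real \<Rightarrow> 'w \<Rightarrow> real ^ 'd"
    and J :: "nat \<Rightarrow> nat \<Rightarrow> nat \<Rightarrow> 'w \<Rightarrow> nat"
    and X :: "nat \<Rightarrow> (nat \<Rightarrow> 'd torus) \<Rightarrow> nat \<Rightarrow> real \<Rightarrow> 'w \<Rightarrow> 'd torus"
  assumes b: "C1_torus b"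
    and lam_nonneg: "\<And>z. 0 \<le> lam z"
    and lam_lipschitz: "L-lipschitz_on UNIV lam"
    and system: "\<And>N. 1 \<le> N \<Longrightarrow> particle_system \<Omega> b lam N (E N) (B N) (J N) (X N)"
    and pos: "0 < c1" "0 < a" "0 < \<gamma>0" "0 < c2" "0 < C5"
    and K_contraction: "\<And>\<gamma> \<mu> \<nu>. \<gamma> \<in> {0<..\<gamma>0} \<Longrightarrow>
      \<mu> \<in> space (prob_algebra borel) \<Longrightarrow> \<nu> \<in> space (prob_algebra borel) \<Longrightarrow>
      wasserstein (rho a) (\<mu> \<bind> euler_kernel b \<gamma>) (\<nu> \<bind> euler_kernel b \<gamma>)
        \<le> (1 - c1 * \<gamma>) * wasserstein (rho a) \<mu> \<nu>"
    and R_contraction: "\<And>\<gamma> N \<mu> \<nu>. \<gamma> \<in> {0<..\<gamma>0} \<Longrightarrow> 1 \<le> N \<Longrightarrow>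
      \<mu> \<in> space (prob_algebra (configs N)) \<Longrightarrow> \<nu> \<in> space (prob_algebra (configs N)) \<Longrightarrow>
      wasserstein (rho_N a N) (\<mu> \<bind> R_kernel b lam N \<gamma>) (\<nu> \<bind> R_kernel b lam N \<gamma>)
        \<le> (1 - \<gamma> * kappa c1 c2 L lam \<gamma>) * wasserstein (rho_N a N) \<mu> \<nu>"
    and discretization: "\<And>N \<gamma> m \<mu>. 1 \<le> N \<Longrightarrow> \<gamma> \<in> {0<..\<gamma>0} \<Longrightarrow>
      \<mu> \<in> space (prob_algebra (configs N)) \<Longrightarrow>
      wasserstein (rho_N a N)
          (((\<lambda>\<nu>. \<nu> \<bind> R_kernel b lam N \<gamma>) ^^ m) \<mu>)
          (\<mu> \<bind> P_kernel \<Omega> N (X N) (real m * \<gamma>))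
        \<le> sqrt \<gamma> * real N * C5 * \<gamma> * (\<Sum>s=1..m. (1 - \<gamma> * kappa c1 c2 L lam \<gamma>) ^ (s - 1))"
  shows "\<forall>N\<ge>1. \<forall>\<gamma>\<in>{0<..\<gamma>0}. kappa c1 c2 L lam \<gamma> > 0 \<longrightarrow>
    (\<forall>\<mu> \<mu>'. invariant_measure (configs N) (R_kernel b lam N \<gamma>) \<mu> \<and>
        (\<forall>t\<ge>0. invariant_measure (configs N) (P_kernel \<Omega> N (X N) t) \<mu>') \<longrightarrow>
      wasserstein (rho_N a N) \<mu> \<mu>' \<le> sqrt \<gamma> * real N * inverse (kappa c1 c2 L lam \<gamma>) * C5)"
proof (intro allI impI ballI, elim conjE)
  fix N :: nat and \<gamma> :: real and \<mu> \<mu>' :: "(nat \<Rightarrow> 'd torus) measure"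
  let ?W = "wasserstein (rho_N a N)" and ?R = "R_kernel b lam N \<gamma>" and ?\<kappa> = "kappa c1 c2 L lam \<gamma>"
  assume N: "1 \<le> N" and \<gamma>: "\<gamma> \<in> {0<..\<gamma>0}" and \<kappa>: "0 < ?\<kappa>"
    and \<mu>: "invariant_measure (configs N) ?R \<mu>"
    and \<mu>': "\<forall>t\<ge>0. invariant_measure (configs N) (P_kernel \<Omega> N (X N) t) \<mu>'"
  have "b \<in> borel_measurable borel" "lam \<in> borel_measurable borel"
    using C1_torus_continuous[OF b] lipschitz_on_continuous_on[OF lam_lipschitz]
    by (simp_all add: borel_measurable_continuous_onI)
  note R = measurable_R_kernel[OF N this, of \<gamma>]
  have \<mu>_prob: "\<mu> \<in> space (prob_algebra (configs N))" and \<mu>_inv: "\<mu> \<bind> ?R = \<mu>"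
    using \<mu> by (auto simp: invariant_measure_def)
  have \<mu>'_prob: "\<mu>' \<in> space (prob_algebra (configs N))"
    and \<mu>'_inv: "\<mu>' \<bind> P_kernel \<Omega> N (X N) \<gamma> = \<mu>'"
    using \<mu>' \<gamma> by (auto simp: invariant_measure_def)
  \<comment> \<open>The measure is viewed as a kernel on a dummy parameter space, constantly equal
    to \<mu>', followed by the kernel \<open>?R\<close>.\<close>
  have \<mu>'R_prob: "\<mu>' \<bind> ?R \<in> space (prob_algebra (configs N))"
    using measurable_space[OF measurable_bind_prob_space[OF measurable_const[OF \<mu>'_prob] R,
        of "count_space UNIV"]] by simp
  have "?W \<mu> \<mu>' \<le> ?W \<mu> (\<mu>' \<bind> ?R) + ?W (\<mu>' \<bind> ?R) \<mu>'"
    by (rule wasserstein_rho_N_triangle[OF pos(2) N \<mu>_prob \<mu>'R_prob \<mu>'_prob])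
  \<comment> \<open>Invariance allows \<mu> to be replaced by its image under \<open>?R\<close>,
    which puts both arguments in the form required by the contraction.\<close>
  also have "?W \<mu> (\<mu>' \<bind> ?R) \<le> (1 - \<gamma> * ?\<kappa>) * ?W \<mu> \<mu>'"
    using R_contraction[OF \<gamma> N \<mu>_prob \<mu>'_prob] by (simp add: \<mu>_inv)
  \<comment> \<open>For \<open>m = 1\<close> the geometric sum is its single term of exponent 0, and
    \<mu>' is invariant at time \<gamma>.\<close>
  also have "?W (\<mu>' \<bind> ?R) \<mu>' \<le> sqrt \<gamma> * real N * C5 * \<gamma>"
    using discretization[OF N \<gamma> \<mu>'_prob, of 1] by (simp add: \<mu>'_inv)
  \<comment> \<open>The distance is a real number, so its multiple on the right can be subtracted.
    What remains is divided by \<gamma> and then by \<open>?\<kappa>\<close>, both positive.\<close>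
  finally have "\<gamma> * (?\<kappa> * ?W \<mu> \<mu>') \<le> \<gamma> * (sqrt \<gamma> * real N * C5)"
    by (simp add: algebra_simps)
  then have "?\<kappa> * ?W \<mu> \<mu>' \<le> sqrt \<gamma> * real N * C5"
    using \<gamma> by simp
  then show "?W \<mu> \<mu>' \<le> sqrt \<gamma> * real N * inverse ?\<kappa> * C5"
    using \<kappa> by (simp add: field_simps)
qed

end
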